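(* Let $\sigma$ be a $*$-permutation and $x(\sigma)=x_{i_1}x_{i_2}\cdots x_{i_n}$ the corresponding word in $X^*$. Then $\sigma$ is $132$-avoiding if and only if the word $x(\sigma)$ has non-increasing indices (that is, $i_1\ge i_2\ge\dots\ge i_n$). Also, $\sigma$ is $231$-avoiding if and only if the word $x(\sigma)$ has no decrease of an index larger than $1$ (that is, $i_j-i_{j+1}\le 1$ for all $j=1,\dots,n-1$).
   Context: $X=\{x_0,x_1,x_2,\dots\}$ and $X^*$ is the free monoid on $X$. A $*$-permutation of length $n$ is a map $\sigma:\mathbb N^+\to\{1,\dots,n\}\cup\{*\}$, $\mathbb N^+=\{1,2,\dots\}$, such that each of $1,\dots,n$ has exactly one preimage; it is viewed as an infinite sequence of terms. The symbols $1,\dots,n$ are called concrete, and $*$ is considered larger than every concrete symbol. For $1\le i\le n$, $\mathsf{inv}_i(\sigma)=\#\{j\mid 1\le j<\sigma^{-1}(i),\ \sigma(j)>i\}$ (terms equal to $*$ are counted), and $x(\sigma)=x_{\mathsf{inv}_1(\sigma)}x_{\mathsf{inv}_2(\sigma)}\cdots x_{\mathsf{inv}_n(\sigma)}$. Let $z$ be the position of the last concrete symbol of $\sigma$. $\sigma$ is $132$-avoiding if there are no indices $1\le a<b<c\le z$ with $\sigma(a)<\sigma(c)<\sigma(b)$, and $231$-avoiding if there are no indices $1\le a<b<c\le z$ with $\sigma(c)<\sigma(a)<\sigma(b)$ (in both cases $\sigma(b)$ may be $*$, while the other two symbols must be concrete). *)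

theory Defs
  imports "HOL-Library.Extended_Nat"
begin

text \<open>
  Symbols of a \<open>*\<close>-permutation are elements of \<^typ>\<open>enat\<close>: \<open>enat i\<close> is the concrete symbol \<open>i\<close>,
  and \<open>\<infinity>\<close> is the symbol \<open>*\<close>, so that the library order makes \<open>*\<close> larger than every concrete
  symbol. Positions are the positive naturals; the value of the function at \<open>0\<close> is never used.
\<close>

definition star_perm :: "nat \<Rightarrow> (nat \<Rightarrow> enat) \<Rightarrow> bool" where
  "star_perm n \<sigma> \<longleftrightarrow>
     (\<forall>j\<ge>1. \<sigma> j \<in> enat ` {1..n} \<union> {\<infinity>}) \<and>
     (\<forall>i\<in>{1..n}. \<exists>!j. 1 \<le> j \<and> \<sigma> j = enat i)"

definition position :: "(nat \<Rightarrow> enat) \<Rightarrow> nat \<Rightarrow> nat" where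
  "position \<sigma> i = (THE j. 1 \<le> j \<and> \<sigma> j = enat i)"

definition inversions :: "(nat \<Rightarrow> enat) \<Rightarrow> nat \<Rightarrow> nat" where
  "inversions \<sigma> i = card {j. 1 \<le> j \<and> j < position \<sigma> i \<and> \<sigma> j > enat i}"

text \<open>The generators \<open>x\<^sub>0, x\<^sub>1, \<dots>\<close>; the free monoid on them is the type of lists under append.\<close>

datatype generator = X nat

definition word_of :: "nat \<Rightarrow> (nat \<Rightarrow> enat) \<Rightarrow> generator list" where
  "word_of n \<sigma> = map (\<lambda>i. X (inversions \<sigma> i)) [1..<Suc n]"

text \<open>
  For a \<open>*\<close>-permutation of length \<open>0\<close> this is an unspecified number. That is harmless below: the
  symbols at \<open>a\<close> and \<open>c\<close> in a pattern are strictly smaller than another symbol, hence concrete.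
\<close>

definition last_concrete :: "(nat \<Rightarrow> enat) \<Rightarrow> nat" where
  "last_concrete \<sigma> = Max {j. 1 \<le> j \<and> \<sigma> j \<noteq> \<infinity>}"

definition avoids_132 :: "(nat \<Rightarrow> enat) \<Rightarrow> bool" where
  "avoids_132 \<sigma> \<longleftrightarrow>
     \<not> (\<exists>a b c. 1 \<le> a \<and> a < b \<and> b < c \<and> c \<le> last_concrete \<sigma> \<and> \<sigma> a < \<sigma> c \<and> \<sigma> c < \<sigma> b)"

definition avoids_231 :: "(nat \<Rightarrow> enat) \<Rightarrow> bool" where
  "avoids_231 \<sigma> \<longleftrightarrow>
     \<not> (\<exists>a b c. 1 \<le> a \<and> a < b \<and> b < c \<and> c \<le> last_concrete \<sigma> \<and> \<sigma> c < \<sigma> a \<and> \<sigma> a < \<sigma> b)"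

end

theory Submission imports Defs begin

text \<open>
  Both claims are local: they compare \<open>inv\<^sub>k\<close> with \<open>inv\<^sub>k\<^sub>+\<^sub>1\<close>, so only the positions of the
  consecutive symbols \<open>k\<close> and \<open>k + 1\<close> matter. Let \<open>d\<close> be the number of symbols larger than
  \<open>k + 1\<close> standing strictly between them. The symbols larger than \<open>k\<close> are \<open>k + 1\<close> and those
  larger than \<open>k + 1\<close>. Hence \<open>inv\<^sub>k\<^sub>+\<^sub>1 = inv\<^sub>k + d\<close> if \<open>k\<close> comes first
  (\<open>inversions_Suc_ascent\<close>), and \<open>inv\<^sub>k = inv\<^sub>k\<^sub>+\<^sub>1 + 1 + d\<close> if \<open>k + 1\<close> comes first
  (\<open>inversions_Suc_descent\<close>). So the index increases from \<open>k\<close> to \<open>k + 1\<close> exactly when these two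
  symbols are the outer terms of a 132 pattern, and it drops by more than 1 exactly when they are
  the outer terms of a 231 pattern.

  It remains to see that a pattern, if there is one, can be found with consecutive outer values
  (\<open>avoids_132_iff_consecutive\<close>, \<open>avoids_231_iff_consecutive\<close>). Given a pattern with middle
  position \<open>b\<close>, run through the values from the smaller to the larger outer symbol. One end of this
  range lies to the left of \<open>b\<close> and the other to the right, so somewhere two consecutive values
  \<open>k\<close>, \<open>k + 1\<close> lie on different sides of \<open>b\<close>. The symbol at \<open>b\<close> is larger than all of these values,
  so \<open>k\<close>, \<open>k + 1\<close> and \<open>b\<close> form a pattern of the same kind.
\<close>

section \<open>Positions of the concrete symbols\<close>

lemma position_pos_and_value:
  assumes "star_perm n \<sigma>" "k \<in> {1..n}"
  shows "1 \<le> position \<sigma> k \<and> \<sigma> (position \<sigma> k) = enat k"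
proof -
  have "\<exists>!j. 1 \<le> j \<and> \<sigma> j = enat k"
    using assms by (auto simp: star_perm_def)
  then show ?thesis unfolding position_def by (rule theI')
qed

lemma position_eqI:
  assumes "star_perm n \<sigma>" "1 \<le> j" "\<sigma> j = enat k"
  shows "k \<in> {1..n}" "j = position \<sigma> k"
proof -
  show k: "k \<in> {1..n}" using assms by (auto simp: star_perm_def)
  then have "\<exists>!j. 1 \<le> j \<and> \<sigma> j = enat k"
    using assms by (auto simp: star_perm_def)
  then show "j = position \<sigma> k"
    using assms position_pos_and_value[OF assms(1) k] by blast
qed

text \<open>
  This supplies the bound \<open>c \<le> z\<close> for patterns whose last term is found as the position of a
  symbol.
\<close>

lemma position_le_last_concrete:
  assumes "star_perm n \<sigma>" "k \<in> {1..n}"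
  shows "position \<sigma> k \<le> last_concrete \<sigma>"
proof -
  have "{j. 1 \<le> j \<and> \<sigma> j \<noteq> \<infinity>} \<subseteq> position \<sigma> ` {1..n}"
    using position_eqI[OF assms(1)] by fastforce
  then have "finite {j. 1 \<le> j \<and> \<sigma> j \<noteq> \<infinity>}" by (rule finite_subset) simp
  then show ?thesis
    unfolding last_concrete_def
    using position_pos_and_value[OF assms] by (intro Max_ge) auto
qed

section \<open>Inversion numbers of consecutive symbols\<close>

definition larger_between :: "(nat \<Rightarrow> enat) \<Rightarrow> nat \<Rightarrow> nat \<Rightarrow> nat \<Rightarrow> nat set" where
  "larger_between \<sigma> a c k = {b. a < b \<and> b < c \<and> enat k < \<sigma> b}"

lemma finite_larger_between: "finite (larger_between \<sigma> a c k)"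
  by (rule finite_subset[of _ "{..<c}"]) (auto simp: larger_between_def)

lemma inversions_eq_card_larger_between:
  "inversions \<sigma> k = card (larger_between \<sigma> 0 (position \<sigma> k) k)"
  unfolding inversions_def larger_between_def
  by (rule arg_cong[of _ _ card]) auto

lemma larger_iff_larger_Suc:
  assumes "star_perm n \<sigma>" "0 < b" "b \<noteq> position \<sigma> (Suc k)"
  shows "enat k < \<sigma> b \<longleftrightarrow> enat (Suc k) < \<sigma> b"
proof -
  have "\<sigma> b \<noteq> enat (Suc k)"
    using position_eqI(2)[OF assms(1), of b "Suc k"] assms by auto
  then show ?thesis by (cases "\<sigma> b") auto
qed

text \<open>
  Up to the position of \<open>k\<close>, the symbols larger than \<open>k\<close> and those larger than \<open>k + 1\<close> are the
  same, since \<open>k + 1\<close> has not occurred yet. The remaining inversions of \<open>k + 1\<close> lie between the two.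
\<close>

lemma inversions_Suc_ascent:
  assumes "star_perm n \<sigma>" "1 \<le> k" "k < n" "position \<sigma> k < position \<sigma> (Suc k)"
  shows "inversions \<sigma> (Suc k) =
    inversions \<sigma> k + card (larger_between \<sigma> (position \<sigma> k) (position \<sigma> (Suc k)) (Suc k))"
proof -
  let ?p = "position \<sigma> k" and ?q = "position \<sigma> (Suc k)"
  have p: "\<sigma> ?p = enat k" "1 \<le> ?p"
    using position_pos_and_value[OF assms(1), of k] assms by auto
  have "larger_between \<sigma> 0 ?q (Suc k) = larger_between \<sigma> 0 ?p k \<union> larger_between \<sigma> ?p ?q (Suc k)"
  proof (rule set_eqI)
    fix b
    show "b \<in> larger_between \<sigma> 0 ?q (Suc k) \<longleftrightarrow>
          b \<in> larger_between \<sigma> 0 ?p k \<union> larger_between \<sigma> ?p ?q (Suc k)"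
      using larger_iff_larger_Suc[OF assms(1), of b k] p assms(4)
      by (cases b ?p rule: linorder_cases) (auto simp: larger_between_def)
  qed
  moreover have "larger_between \<sigma> 0 ?p k \<inter> larger_between \<sigma> ?p ?q (Suc k) = {}"
    by (auto simp: larger_between_def)
  ultimately show ?thesis
    by (simp add: inversions_eq_card_larger_between card_Un_disjoint finite_larger_between)
qed

text \<open>
  Every inversion of \<open>k + 1\<close> is one of \<open>k\<close>; in addition \<open>k\<close> has the inversion with \<open>k + 1\<close> itself
  and those lying between the two.
\<close>

lemma inversions_Suc_descent:
  assumes "star_perm n \<sigma>" "1 \<le> k" "k < n" "position \<sigma> (Suc k) < position \<sigma> k"
  shows "inversions \<sigma> k =
    inversions \<sigma> (Suc k) + 1 +
    card (larger_between \<sigma> (position \<sigma> (Suc k)) (position \<sigma> k) (Suc k))"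
proof -
  let ?p = "position \<sigma> k" and ?q = "position \<sigma> (Suc k)"
  have q: "\<sigma> ?q = enat (Suc k)" "1 \<le> ?q"
    using position_pos_and_value[OF assms(1), of "Suc k"] assms by auto
  have "larger_between \<sigma> 0 ?p k =
    insert ?q (larger_between \<sigma> 0 ?q (Suc k) \<union> larger_between \<sigma> ?q ?p (Suc k))"
  proof (rule set_eqI)
    fix b
    show "b \<in> larger_between \<sigma> 0 ?p k \<longleftrightarrow>
      b \<in> insert ?q (larger_between \<sigma> 0 ?q (Suc k) \<union> larger_between \<sigma> ?q ?p (Suc k))"
      using larger_iff_larger_Suc[OF assms(1), of b k] q assms(4)
      by (cases b ?q rule: linorder_cases) (auto simp: larger_between_def)
  qed
  moreover have "larger_between \<sigma> 0 ?q (Suc k) \<inter> larger_between \<sigma> ?q ?p (Suc k) = {}"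
    "?q \<notin> larger_between \<sigma> 0 ?q (Suc k) \<union> larger_between \<sigma> ?q ?p (Suc k)"
    by (auto simp: larger_between_def)
  ultimately show ?thesis
    by (simp add: inversions_eq_card_larger_between card_Un_disjoint finite_larger_between)
qed

section \<open>Patterns with consecutive outer values\<close>

lemma predicate_switches_at_successor:
  fixes k m :: nat
  assumes "k < m" "P k" "\<not> P m"
  obtains l where "k \<le> l" "l < m" "P l" "\<not> P (Suc l)"
proof -
  have "\<exists>l. k \<le> l \<and> l < m \<and> P l \<and> \<not> P (Suc l)"
    using assms
  proof (induction m)
    case (Suc m)
    show ?case
    proof (cases "P m")
      case True
      then show ?thesis using Suc.prems by (intro exI[of _ m]) auto
    next
      case False
      then have "k < m" using Suc.prems by (cases "k = m") auto
      then show ?thesis using Suc.IH Suc.prems False less_SucI by blast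
    qed
  qed simp
  then show ?thesis using that by blast
qed

text \<open>
  The two kinds of pattern differ in the side of the middle position \<open>b\<close> on which the smaller
  outer symbol stands. So \<open>S\<close> will be the positions before \<open>b\<close> for 132 and those after \<open>b\<close> for 231.
\<close>

lemma consecutive_values_separated:
  assumes "star_perm n \<sigma>" "1 \<le> a" "1 \<le> c" "\<sigma> a < \<sigma> c" "\<sigma> c < \<infinity>" "a \<in> S" "c \<notin> S"
  obtains k where "1 \<le> k" "k < n" "enat (Suc k) \<le> \<sigma> c"
    "position \<sigma> k \<in> S" "position \<sigma> (Suc k) \<notin> S"
proof -
  obtain i m where im: "\<sigma> a = enat i" "\<sigma> c = enat m" "i < m"
    using assms(4,5) by (cases "\<sigma> a"; cases "\<sigma> c") auto
  note a = position_eqI[OF assms(1,2) im(1)] and c = position_eqI[OF assms(1,3) im(2)]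
  obtain k where "i \<le> k" "k < m" "position \<sigma> k \<in> S" "position \<sigma> (Suc k) \<notin> S"
    using predicate_switches_at_successor[of i m "\<lambda>k. position \<sigma> k \<in> S"] im(3) a c assms(6,7)
    by auto
  then show ?thesis using a c im that[of k] by auto
qed

lemma avoids_132_iff_consecutive:
  assumes "star_perm n \<sigma>"
  shows "avoids_132 \<sigma> \<longleftrightarrow> (\<forall>k. 1 \<le> k \<and> k < n \<longrightarrow>
    larger_between \<sigma> (position \<sigma> k) (position \<sigma> (Suc k)) (Suc k) = {})"
proof (rule iffI; (intro allI impI)?)
  fix k assume av: "avoids_132 \<sigma>" and k: "1 \<le> k \<and> k < n"
  show "larger_between \<sigma> (position \<sigma> k) (position \<sigma> (Suc k)) (Suc k) = {}"
  proof (rule equals0I)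
    fix b assume "b \<in> larger_between \<sigma> (position \<sigma> k) (position \<sigma> (Suc k)) (Suc k)"
    then have b: "position \<sigma> k < b" "b < position \<sigma> (Suc k)" "enat (Suc k) < \<sigma> b"
      by (auto simp: larger_between_def)
    have outer: "1 \<le> position \<sigma> k" "\<sigma> (position \<sigma> k) = enat k"
        "\<sigma> (position \<sigma> (Suc k)) = enat (Suc k)" "position \<sigma> (Suc k) \<le> last_concrete \<sigma>"
      using position_pos_and_value[OF assms, of k] position_pos_and_value[OF assms, of "Suc k"]
        position_le_last_concrete[OF assms, of "Suc k"] k by auto
    have less: "\<sigma> (position \<sigma> k) < \<sigma> (position \<sigma> (Suc k))" "\<sigma> (position \<sigma> (Suc k)) < \<sigma> b"
      using b(3) by (simp_all add: outer)
    show False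
      using av outer(1,4) b less unfolding avoids_132_def by blast
  qed
next
  assume empty: "\<forall>k. 1 \<le> k \<and> k < n \<longrightarrow>
    larger_between \<sigma> (position \<sigma> k) (position \<sigma> (Suc k)) (Suc k) = {}"
  show "avoids_132 \<sigma>"
    unfolding avoids_132_def
  proof
    assume "\<exists>a b c. 1 \<le> a \<and> a < b \<and> b < c \<and> c \<le> last_concrete \<sigma> \<and> \<sigma> a < \<sigma> c \<and> \<sigma> c < \<sigma> b"
    then obtain a b c where abc: "1 \<le> a" "a < b" "b < c" "\<sigma> a < \<sigma> c" "\<sigma> c < \<sigma> b"
      by blast
    have conc: "\<sigma> c < \<infinity>" using abc(5) by (cases "\<sigma> c") auto
    obtain k where k: "1 \<le> k" "k < n" "enat (Suc k) \<le> \<sigma> c"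
        "position \<sigma> k \<in> {..<b}" "position \<sigma> (Suc k) \<notin> {..<b}"
      using consecutive_values_separated[OF assms, of a c "{..<b}"] abc conc by auto
    have larger: "enat (Suc k) < \<sigma> b" using k(3) abc(5) by (rule le_less_trans)
    then have "position \<sigma> (Suc k) \<noteq> b"
      using position_pos_and_value[OF assms, of "Suc k"] k by auto
    then have "b \<in> larger_between \<sigma> (position \<sigma> k) (position \<sigma> (Suc k)) (Suc k)"
      using k larger by (auto simp: larger_between_def)
    then show False using empty k by auto
  qed
qed

lemma avoids_231_iff_consecutive:
  assumes "star_perm n \<sigma>"
  shows "avoids_231 \<sigma> \<longleftrightarrow> (\<forall>k. 1 \<le> k \<and> k < n \<longrightarrow>
    larger_between \<sigma> (position \<sigma> (Suc k)) (position \<sigma> k) (Suc k) = {})"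
proof (rule iffI; (intro allI impI)?)
  fix k assume av: "avoids_231 \<sigma>" and k: "1 \<le> k \<and> k < n"
  show "larger_between \<sigma> (position \<sigma> (Suc k)) (position \<sigma> k) (Suc k) = {}"
  proof (rule equals0I)
    fix b assume "b \<in> larger_between \<sigma> (position \<sigma> (Suc k)) (position \<sigma> k) (Suc k)"
    then have b: "position \<sigma> (Suc k) < b" "b < position \<sigma> k" "enat (Suc k) < \<sigma> b"
      by (auto simp: larger_between_def)
    have outer: "1 \<le> position \<sigma> (Suc k)" "\<sigma> (position \<sigma> k) = enat k"
        "\<sigma> (position \<sigma> (Suc k)) = enat (Suc k)" "position \<sigma> k \<le> last_concrete \<sigma>"
      using position_pos_and_value[OF assms, of k] position_pos_and_value[OF assms, of "Suc k"]
        position_le_last_concrete[OF assms, of k] k by auto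
    have less: "\<sigma> (position \<sigma> k) < \<sigma> (position \<sigma> (Suc k))" "\<sigma> (position \<sigma> (Suc k)) < \<sigma> b"
      using b(3) by (simp_all add: outer)
    show False
      using av outer(1,4) b less unfolding avoids_231_def by blast
  qed
next
  assume empty: "\<forall>k. 1 \<le> k \<and> k < n \<longrightarrow>
    larger_between \<sigma> (position \<sigma> (Suc k)) (position \<sigma> k) (Suc k) = {}"
  show "avoids_231 \<sigma>"
    unfolding avoids_231_def
  proof
    assume "\<exists>a b c. 1 \<le> a \<and> a < b \<and> b < c \<and> c \<le> last_concrete \<sigma> \<and> \<sigma> c < \<sigma> a \<and> \<sigma> a < \<sigma> b"
    then obtain a b c where abc: "1 \<le> a" "a < b" "b < c" "\<sigma> c < \<sigma> a" "\<sigma> a < \<sigma> b"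
      by blast
    have conc: "\<sigma> a < \<infinity>" using abc(5) by (cases "\<sigma> a") auto
    obtain k where k: "1 \<le> k" "k < n" "enat (Suc k) \<le> \<sigma> a"
        "position \<sigma> k \<in> {b<..}" "position \<sigma> (Suc k) \<notin> {b<..}"
      using consecutive_values_separated[OF assms, of c a "{b<..}"] abc conc by auto
    have larger: "enat (Suc k) < \<sigma> b" using k(3) abc(5) by (rule le_less_trans)
    then have "position \<sigma> (Suc k) \<noteq> b"
      using position_pos_and_value[OF assms, of "Suc k"] k by auto
    then have "b \<in> larger_between \<sigma> (position \<sigma> (Suc k)) (position \<sigma> k) (Suc k)"
      using k larger by (auto simp: larger_between_def)
    then show False using empty k by auto
  qed
qed

section \<open>Pattern avoidance and the word\<close>

text \<open>
  Each equivalence is decided by the count for one order of \<open>k\<close> and \<open>k + 1\<close>. In the other order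
  both of its sides hold: the interval of positions is empty, and the count for that order gives
  the inequality.
\<close>

lemma larger_between_empty_iff_inversions:
  assumes "star_perm n \<sigma>" "1 \<le> k" "k < n"
  shows "larger_between \<sigma> (position \<sigma> k) (position \<sigma> (Suc k)) (Suc k) = {} \<longleftrightarrow>
      inversions \<sigma> (Suc k) \<le> inversions \<sigma> k" (is ?ascent)
    and "larger_between \<sigma> (position \<sigma> (Suc k)) (position \<sigma> k) (Suc k) = {} \<longleftrightarrow>
      inversions \<sigma> k \<le> inversions \<sigma> (Suc k) + 1" (is ?descent)
proof -
  let ?p = "position \<sigma> k" and ?q = "position \<sigma> (Suc k)"
  have "\<sigma> ?p \<noteq> \<sigma> ?q"
    using position_pos_and_value[OF assms(1), of k]
      position_pos_and_value[OF assms(1), of "Suc k"] assms by auto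
  then have "?p \<noteq> ?q" by metis
  then consider "?p < ?q" | "?q < ?p" by linarith
  then have "?ascent \<and> ?descent"
  proof cases
    case 1
    then have "larger_between \<sigma> ?q ?p (Suc k) = {}" by (auto simp: larger_between_def)
    with inversions_Suc_ascent[OF assms 1] show ?thesis by (simp add: finite_larger_between)
  next
    case 2
    then have "larger_between \<sigma> ?p ?q (Suc k) = {}" by (auto simp: larger_between_def)
    with inversions_Suc_descent[OF assms 2] show ?thesis by (simp add: finite_larger_between)
  qed
  then show ?ascent ?descent by auto
qed

theorem proposition9:
  fixes n :: nat and \<sigma> :: "nat \<Rightarrow> enat" and i :: "nat \<Rightarrow> nat"
  assumes "star_perm n \<sigma>"
    and "word_of n \<sigma> = map (\<lambda>k. X (i k)) [1..<Suc n]"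
  shows "(avoids_132 \<sigma> \<longleftrightarrow> (\<forall>j. 1 \<le> j \<and> j < n \<longrightarrow> i j \<ge> i (j + 1))) \<and>
         (avoids_231 \<sigma> \<longleftrightarrow> (\<forall>j. 1 \<le> j \<and> j < n \<longrightarrow> int (i j) - int (i (j + 1)) \<le> 1))"
proof -
  have i: "inversions \<sigma> k = i k" if "1 \<le> k" "k \<le> n" for k
    using assms(2) that by (auto simp: word_of_def simp del: upt_Suc)
  have "avoids_132 \<sigma> \<longleftrightarrow> (\<forall>j. 1 \<le> j \<and> j < n \<longrightarrow> i j \<ge> i (j + 1))"
    unfolding avoids_132_iff_consecutive[OF assms(1)]
    using larger_between_empty_iff_inversions(1)[OF assms(1)] i by auto
  moreover have "i k \<le> i (k + 1) + 1 \<longleftrightarrow> int (i k) - int (i (k + 1)) \<le> 1" for k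
    by linarith
  then have "avoids_231 \<sigma> \<longleftrightarrow> (\<forall>j. 1 \<le> j \<and> j < n \<longrightarrow> int (i j) - int (i (j + 1)) \<le> 1)"
    unfolding avoids_231_iff_consecutive[OF assms(1)]
    using larger_between_empty_iff_inversions(2)[OF assms(1)] i by auto
  ultimately show ?thesis by blast
qed

end
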